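(* Let $f(z)=z+a_2z^2+a_3z^3+\cdots\in\mathcal{S}^{*}_{\arcsin}$, with logarithmic coefficients $\gamma_1,\gamma_2$. Then $$-\frac{1}{\pi}\le |\gamma_2|-|\gamma_1|\le \frac{1}{2\pi}.$$ Both inequalities are sharp, i.e. for each of them there is a function in $\mathcal{S}^{*}_{\arcsin}$ for which equality holds.
   Context: Let $\Omega=\{z\in\mathbb{C}:|z|<1\}$. Let $\mathcal{A}$ be the family of analytic functions $f$ on $\Omega$ normalized by $f(z)=z+\sum_{n\ge 2}a_nz^n$, and let $\mathcal{S}\subset\mathcal{A}$ be the subclass of univalent (injective) functions. A Schwarz function is an analytic function $\omega$ on $\Omega$ with $\omega(0)=0$ and $|\omega(z)|\le 1$ for all $z\in\Omega$. For $g,h$ analytic in $\Omega$, $g\prec h$ ($g$ is subordinate to $h$) means there is a Schwarz function $\omega$ with $g(z)=h(\omega(z))$ for all $z\in\Omega$. With $\arcsin$ denoting the principal branch (analytic in $\Omega$, $\arcsin 0=0$), define $$\mathcal{S}^{*}_{\arcsin}=\left\{f\in\mathcal{S}:\ \frac{zf'(z)}{f(z)}\prec 1+\frac{2}{\pi}\arcsin z\right\},$$ where $zf'(z)/f(z)$ is understood to take the value $1$ at $z=0$. The logarithmic coefficients $\gamma_n$ of $f\in\mathcal{S}$ are defined by $\log\frac{f(z)}{z}=2\sum_{n\ge 1}\gamma_nz^n$ (with $\log 1=0$). Explicitly, $\gamma_1=\frac12a_2$ and $\gamma_2=\frac12\left(a_3-\frac12a_2^2\right)$. *)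

theory Defs
  imports "HOL-Complex_Analysis.Complex_Analysis"
begin

abbreviation unit_disc :: "complex set" (\<open>\<Omega>\<close>)
  where "\<Omega> \<equiv> ball 0 1"

text \<open>Functions on the disc are total functions on the complex numbers; their values outside
  the disc are irrelevant.\<close>

definition class_A :: "(complex \<Rightarrow> complex) set"
  where "class_A = {f. f holomorphic_on \<Omega> \<and> f 0 = 0 \<and> deriv f 0 = 1}"

definition class_S :: "(complex \<Rightarrow> complex) set"
  where "class_S = {f \<in> class_A. inj_on f \<Omega>}"

definition schwarz_function :: "(complex \<Rightarrow> complex) \<Rightarrow> bool"
  where "schwarz_function \<omega> \<longleftrightarrow>
    \<omega> holomorphic_on \<Omega> \<and> \<omega> 0 = 0 \<and> (\<forall>z\<in>\<Omega>. norm (\<omega> z) \<le> 1)"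

definition subordinate :: "(complex \<Rightarrow> complex) \<Rightarrow> (complex \<Rightarrow> complex) \<Rightarrow> bool" (infix \<open>\<prec>\<close> 50)
  where "g \<prec> h \<longleftrightarrow> (\<exists>\<omega>. schwarz_function \<omega> \<and> (\<forall>z\<in>\<Omega>. g z = h (\<omega> z)))"

definition class_S_arcsin :: "(complex \<Rightarrow> complex) set"
  where "class_S_arcsin = {f \<in> class_S.
    (\<lambda>z. if z = 0 then 1 else z * deriv f z / f z) \<prec> (\<lambda>z. 1 + 2 / of_real pi * Arcsin z)}"

text \<open>A holomorphic branch of the logarithm of \<open>f z / z\<close> on the whole disc with value \<open>0\<close> at
  the origin. (The principal branch \<^const>\<open>Ln\<close> of \<open>f z / z\<close> may be discontinuous in the disc.)\<close>

definition is_log_ratio :: "(complex \<Rightarrow> complex) \<Rightarrow> (complex \<Rightarrow> complex) \<Rightarrow> bool"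
  where "is_log_ratio f L \<longleftrightarrow>
    L holomorphic_on \<Omega> \<and> L 0 = 0 \<and> (\<forall>z\<in>\<Omega> - {0}. exp (L z) = f z / z)"

definition log_ratio :: "(complex \<Rightarrow> complex) \<Rightarrow> complex \<Rightarrow> complex"
  where "log_ratio f = (SOME L. is_log_ratio f L)"

definition log_coeff :: "(complex \<Rightarrow> complex) \<Rightarrow> nat \<Rightarrow> complex"
  where "log_coeff f n = fps_nth (fps_expansion (log_ratio f) 0) n / 2"

text \<open>For univalent \<open>f\<close> the branch exists, and any such branch has the expansion
  \<open>2 * (\<Sum>n\<ge>1. log_coeff f n * z ^ n)\<close> in the disc; in particular the branch is unique there.\<close>

lemma is_log_ratio_log_ratio:
  assumes "f \<in> class_S"
  shows "is_log_ratio f (log_ratio f)"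
proof -
  from assms have hol: "f holomorphic_on \<Omega>" and f0: "f 0 = 0" and d: "deriv f 0 = 1"
    and inj: "inj_on f \<Omega>"
    by (auto simp: class_S_def class_A_def)
  define g where "g = (\<lambda>z. if z = 0 then 1 else f z / z)"
  have "g holomorphic_on \<Omega>"
    by (rule pole_theorem_open_0[OF hol, of 0]) (auto simp: g_def f0 d)
  moreover have nz: "\<forall>z\<in>\<Omega>. g z \<noteq> 0"
  proof
    fix z :: complex assume z: "z \<in> \<Omega>"
    show "g z \<noteq> 0"
    proof (cases "z = 0")
      case False
      have "f z \<noteq> f 0"
        using inj z False by (metis centre_in_ball inj_onD zero_less_one)
      with False show ?thesis by (simp add: g_def f0)
    qed (simp add: g_def)
  qed
  moreover have "simply_connected \<Omega>"
    by (simp add: convex_imp_simply_connected)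
  ultimately obtain l where l: "l holomorphic_on \<Omega>" "\<forall>z\<in>\<Omega>. g z = exp (l z)"
    using simply_connected_eq_holomorphic_log[of \<Omega>] by auto
  have e0: "exp (l 0) = 1"
    using l(2) by (metis centre_in_ball g_def zero_less_one)
  have "is_log_ratio f (\<lambda>z. l z - l 0)"
    unfolding is_log_ratio_def
  proof (intro conjI ballI)
    show "(\<lambda>z. l z - l 0) holomorphic_on \<Omega>"
      by (intro holomorphic_intros l)
    show "exp (l z - l 0) = f z / z" if "z \<in> \<Omega> - {0}" for z
      using l(2)[rule_format, of z] that e0 by (simp add: exp_diff g_def)
  qed simp
  then show ?thesis
    unfolding log_ratio_def by (rule someI[of "is_log_ratio f"])
qed

lemma is_log_ratio_unique:
  assumes L: "is_log_ratio f L" and M: "is_log_ratio f M" and z: "z \<in> \<Omega>"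
  shows "L z = M z"
proof -
  define h where "h = (\<lambda>z. L z - M z)"
  have holh: "h holomorphic_on \<Omega>"
    using L M unfolding h_def is_log_ratio_def by (intro holomorphic_intros) auto
  have e: "exp (h w) = 1" if "w \<in> \<Omega>" for w
  proof (cases "w = 0")
    case False
    have "exp (L w) = exp (M w)"
      using that False L M by (simp add: is_log_ratio_def)
    then show ?thesis by (simp add: h_def exp_diff)
  qed (use L M in \<open>simp add: h_def is_log_ratio_def\<close>)
  have "deriv h w = 0" if w: "w \<in> \<Omega>" for w
  proof -
    have dh: "(h has_field_derivative deriv h w) (at w)"
      using holh w by (simp add: holomorphic_derivI)
    have "((\<lambda>u. exp (h u)) has_field_derivative exp (h w) * deriv h w) (at w)"
      by (auto intro!: derivative_eq_intros dh)
    moreover have "((\<lambda>u. exp (h u)) has_field_derivative 0) (at w)"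
      by (rule has_field_derivative_transform_within_open[where S = \<Omega> and f = "\<lambda>_. 1"]) (use w e in auto)
    ultimately have "exp (h w) * deriv h w = 0"
      by (rule DERIV_unique)
    then show ?thesis by simp
  qed
  then have "\<And>w. w \<in> \<Omega> \<Longrightarrow> (h has_field_derivative 0) (at w)"
    by (metis holh holomorphic_derivI open_ball)
  then have "h z = h 0"
    using z by (metis DERIV_zero_connected_constant connected_ball open_ball finite.emptyI
        centre_in_ball zero_less_one Diff_empty holh holomorphic_on_imp_continuous_on)
  then show ?thesis
    using L M by (simp add: h_def is_log_ratio_def)
qed

lemma log_coeff_sums:
  assumes f: "f \<in> class_S" and L: "is_log_ratio f L" and z: "z \<in> \<Omega>"
  shows "(\<lambda>n. 2 * (log_coeff f (Suc n) * z ^ Suc n)) sums L z"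
proof -
  have R: "is_log_ratio f (log_ratio f)"
    by (rule is_log_ratio_log_ratio[OF f])
  then have "(\<lambda>n. (deriv ^^ n) (log_ratio f) 0 / fact n * (z - 0) ^ n) sums log_ratio f z"
    by (intro holomorphic_power_series[OF _ z]) (simp add: is_log_ratio_def)
  also have "(\<lambda>n. (deriv ^^ n) (log_ratio f) 0 / fact n * (z - 0) ^ n) =
      (\<lambda>n. 2 * (log_coeff f n * z ^ n))"
    by (simp add: log_coeff_def fps_expansion_def)
  finally have "(\<lambda>n. 2 * (log_coeff f n * z ^ n)) sums L z"
    using is_log_ratio_unique[OF R L z] by simp
  moreover have "log_coeff f 0 = 0"
    using R by (simp add: log_coeff_def fps_expansion_def is_log_ratio_def)
  ultimately show ?thesis
    by (subst sums_Suc_iff) simp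
qed

lemma
  assumes f: "f \<in> class_S"
  defines "a \<equiv> fps_nth (fps_expansion f 0)"
  shows log_coeff_1: "log_coeff f 1 = a 2 / 2"
    and log_coeff_2: "log_coeff f 2 = (a 3 - (a 2)\<^sup>2 / 2) / 2"
proof -
  define L where "L = log_ratio f"
  define F where "F = fps_expansion f 0"
  define G where "G = fps_expansion L 0"
  have L: "L holomorphic_on \<Omega>" "L 0 = 0" "\<And>z. z \<in> \<Omega> - {0} \<Longrightarrow> exp (L z) = f z / z"
    using is_log_ratio_log_ratio[OF f] by (auto simp: L_def is_log_ratio_def)
  have hol: "f holomorphic_on \<Omega>" and f0: "f 0 = 0" and d: "deriv f 0 = 1"
    using f by (auto simp: class_S_def class_A_def)
  have F: "f has_fps_expansion F" and G: "L has_fps_expansion G"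
    unfolding F_def G_def using hol L(1) by (auto intro: has_fps_expansion_fps_expansion[of \<Omega>])
  have feq: "f z = z * exp (L z)" if "z \<in> \<Omega>" for z
    using L(3)[of z] that f0 by (cases "z = 0") auto
  have ode: "z * deriv f z = f z * (1 + z * deriv L z)" if z: "z \<in> \<Omega>" for z
  proof -
    have dL: "(L has_field_derivative deriv L z) (at z)"
      using L(1) z by (simp add: holomorphic_derivI)
    have "((\<lambda>z. z * exp (L z)) has_field_derivative exp (L z) * (1 + z * deriv L z)) (at z)"
      by (auto intro!: derivative_eq_intros dL simp: algebra_simps)
    then have "(f has_field_derivative exp (L z) * (1 + z * deriv L z)) (at z)"
      by (rule has_field_derivative_transform_within_open[where S = \<Omega>]) (use z feq in auto)
    then have "deriv f z = exp (L z) * (1 + z * deriv L z)"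
      by (rule DERIV_imp_deriv)
    then show ?thesis using feq[OF z] by simp
  qed
  have ev: "eventually (\<lambda>z. z * deriv f z = f z * (1 + z * deriv L z)) (nhds 0)"
    using ode by (auto simp: eventually_nhds intro!: exI[of _ \<Omega>])
  have "(\<lambda>z. z * deriv f z) has_fps_expansion fps_X * fps_deriv F"
    by (intro fps_expansion_intros F)
  moreover have "(\<lambda>z. f z * (1 + z * deriv L z)) has_fps_expansion F * (1 + fps_X * fps_deriv G)"
    by (intro fps_expansion_intros F G)
  ultimately have eq: "fps_X * fps_deriv F = F * (1 + fps_X * fps_deriv G)"
    using has_fps_expansion_cong[OF ev refl] fps_expansion_unique_complex by blast
  have F01: "fps_nth F 0 = 0" "fps_nth F 1 = 1"
    by (simp_all add: F_def fps_expansion_def f0 d)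
  have c: "fps_nth (fps_X * fps_deriv F) n = fps_nth (F * (1 + fps_X * fps_deriv G)) n" for n
    by (simp add: eq)
  have 1: "fps_nth G 1 = fps_nth F 2"
    using c[of 2] F01 by (simp add: fps_mult_nth numeral_2_eq_2)
  have 2: "3 * fps_nth F 3 = fps_nth F 3 + fps_nth F 2 * fps_nth G 1 + 2 * fps_nth G 2"
    using c[of 3] F01 by (simp add: fps_mult_nth numeral_2_eq_2 numeral_3_eq_3)
  show "log_coeff f 1 = a 2 / 2"
    using 1 by (simp add: log_coeff_def a_def F_def G_def L_def)
  have "fps_nth G 2 = fps_nth F 3 - (fps_nth F 2)\<^sup>2 / 2"
    using 2 unfolding 1 by (simp add: power2_eq_square field_simps)
  then show "log_coeff f 2 = (a 3 - (a 2)\<^sup>2 / 2) / 2"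
    by (simp add: log_coeff_def a_def F_def G_def L_def)
qed

end

theory Submission
  imports Defs
begin

text \<open>If \<open>z f'(z) / f(z) = 1 + (2 / \<pi>) arcsin (\<omega>(z))\<close> with \<open>\<omega>(z) = c\<^sub>1 z + c\<^sub>2 z\<^sup>2 + \<dots>\<close>, then
  \<open>\<gamma>\<^sub>1 = c\<^sub>1 / \<pi>\<close> and \<open>\<gamma>\<^sub>2 = c\<^sub>2 / (2 \<pi>)\<close>, so both bounds follow from \<open>\<bar>c\<^sub>n\<bar> \<le> 1\<close>. Equality holds for
  \<open>\<omega>(z) = z\<close> and \<open>\<omega>(z) = z\<^sup>2\<close>. Solving the differential equation for \<open>f\<close> with a prescribed \<open>\<omega>\<close>
  gives a function with \<open>Re (z f'(z) / f(z)) > 0\<close>. In the coordinate \<open>z = e\<^sup>w\<close> it lifts to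
  a function with derivative of positive real part on the convex half-plane \<open>Re w < 0\<close>, which forces
  univalence.\<close>

text \<open>The Noshiro-Warschawski argument: along the segment from \<open>a\<close> to
  \<open>b\<close>, dividing \<open>g\<close> by \<open>b - a\<close> cancels the factor from the
  chain rule. The real part of the quotient then has derivative \<open>Re (g' (p t)) > 0\<close>, so
  it increases strictly and \<open>g a = g b\<close> is impossible.\<close>

lemma inj_on_convex_if_Re_deriv_pos:
  fixes g :: "complex \<Rightarrow> complex"
  assumes "convex S"
    and der: "\<And>z. z \<in> S \<Longrightarrow> (g has_field_derivative g' z) (at z)"
    and pos: "\<And>z. z \<in> S \<Longrightarrow> Re (g' z) > 0"
  shows "inj_on g S"
proof (rule inj_onI, rule ccontr)
  fix a b assume ab: "a \<in> S" "b \<in> S" "g a = g b" "a \<noteq> b"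
  define p where "p = (\<lambda>t::real. a + of_real t * (b - a))"
  have pS: "p t \<in> S" if "0 \<le> t" "t \<le> 1" for t
    using convexD_alt[OF \<open>convex S\<close> ab(1,2) that]
    by (simp add: p_def algebra_simps scaleR_conv_of_real)
  have "\<exists>y. ((\<lambda>t. Re (g (p t) / (b - a))) has_real_derivative y) (at t) \<and> 0 < y"
    if t: "0 \<le> t" "t \<le> 1" for t
  proof (intro exI conjI)
    have "(p has_vector_derivative (b - a)) (at t)"
      unfolding p_def by (auto intro!: derivative_eq_intros)
    then have "((g \<circ> p) has_vector_derivative ((b - a) * g' (p t))) (at t)"
      by (rule field_vector_diff_chain_at) (rule der[OF pS[OF t]])
    then have "((\<lambda>t. g (p t) / (b - a)) has_vector_derivative ((b - a) * g' (p t)) / (b - a)) (at t)"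
      by (intro has_vector_derivative_divide) (simp add: o_def)
    then have "((\<lambda>t. g (p t) / (b - a)) has_vector_derivative g' (p t)) (at t)"
      using ab(4) by simp
    then show "((\<lambda>t. Re (g (p t) / (b - a))) has_real_derivative Re (g' (p t))) (at t)"
      by (simp add: has_vector_derivative_complex_iff)
  qed (rule pos[OF pS[OF t]])
  then have "Re (g (p 0) / (b - a)) < Re (g (p 1) / (b - a))"
    using DERIV_pos_imp_increasing[of 0 1 "\<lambda>t. Re (g (p t) / (b - a))"] by simp
  then show False
    using ab(3) by (simp add: p_def)
qed

lemma inj_on_times_exp:
  assumes hol: "L holomorphic_on \<Omega>"
    and pos: "\<And>z. z \<in> \<Omega> \<Longrightarrow> Re (1 + z * deriv L z) > 0"
  shows "inj_on (\<lambda>z. z * exp (L z)) \<Omega>"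
proof (rule inj_onI)
  fix z1 z2 assume z: "z1 \<in> \<Omega>" "z2 \<in> \<Omega>" and eq: "z1 * exp (L z1) = z2 * exp (L z2)"
  show "z1 = z2"
  proof (cases "z1 = 0 \<or> z2 = 0")
    case True
    with eq show ?thesis by auto
  next
    case False
    define H where "H = {w. Re w < 0}"
    define g where "g = (\<lambda>w. w + L (exp w))"
    have expH: "exp w \<in> \<Omega>" if "w \<in> H" for w
      using that by (simp add: H_def)
    have inj: "inj_on g H"
    proof (rule inj_on_convex_if_Re_deriv_pos)
      show "convex H"
        unfolding H_def by (rule convex_halfspace_Re_lt)
    next
      fix w assume w: "w \<in> H"
      have "(L has_field_derivative deriv L (exp w)) (at (exp w))"
        using hol expH[OF w] by (simp add: holomorphic_derivI)
      then show "(g has_field_derivative 1 + exp w * deriv L (exp w)) (at w)"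
        unfolding g_def by (auto intro!: derivative_eq_intros DERIV_chain2[of L])
      show "Re (1 + exp w * deriv L (exp w)) > 0"
        using pos[OF expH[OF w]] .
    qed
    have LnH: "Ln u \<in> H" if "u \<in> \<Omega>" "u \<noteq> 0" for u
      using that by (simp add: H_def Re_Ln)
    have "exp (g (Ln z1)) = exp (g (Ln z2))"
      using eq False by (simp add: g_def exp_add)
    then obtain n where n: "g (Ln z1) = g (Ln z2) + of_int (2 * n) * of_real pi * \<i>"
      unfolding exp_eq by auto
    \<comment> \<open>\<open>g\<close> commutes with translation by multiples of
      \<open>2 * pi * \<i>\<close>, so the period left over from \<open>exp_eq\<close> can be moved
      into the argument. The translation is vertical and therefore keeps \<open>v\<close> in
      \<open>H\<close>.\<close>
    define v where "v = Ln z2 + of_int (2 * n) * of_real pi * \<i>"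
    have ev: "exp v = z2"
      using False exp_eq[of v "Ln z2"] by (auto simp: v_def)
    then have "g (Ln z1) = g v"
      using n False by (simp add: g_def v_def)
    moreover have "v \<in> H"
      using LnH[of z2] z False by (simp add: H_def v_def)
    ultimately have "Ln z1 = v"
      using inj LnH[of z1] z False by (auto dest: inj_onD)
    then show ?thesis
      using ev False by (metis exp_Ln)
  qed
qed

text \<open>Cauchy's inequality on the circle of radius \<open>r < 1\<close> gives
  \<open>?c * r ^ n \<le> 1\<close>. The bound follows by letting \<open>r\<close> tend to 1 from
  the left, because nothing is known about \<open>\<omega>\<close> on the unit circle
  itself.\<close>

lemma schwarz_function_coeff_le_1:
  assumes "schwarz_function \<omega>"
  shows "norm (fps_nth (fps_expansion \<omega> 0) n) \<le> 1"
proof -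
  let ?c = "norm (fps_nth (fps_expansion \<omega> 0) n)"
  have hol: "\<omega> holomorphic_on \<Omega>" and le: "\<And>z. z \<in> \<Omega> \<Longrightarrow> norm (\<omega> z) \<le> 1"
    using assms by (auto simp: schwarz_function_def)
  have "?c * r ^ n \<le> 1" if r: "0 < r" "r < 1" for r :: real
  proof -
    have "norm ((deriv ^^ n) \<omega> 0) \<le> fact n * 1 / r ^ n"
    proof (rule Cauchy_inequality)
      show "\<omega> holomorphic_on ball 0 r"
        using hol r by (auto elim: holomorphic_on_subset)
      show "continuous_on (cball 0 r) \<omega>"
        using holomorphic_on_imp_continuous_on[OF hol] r by (auto elim: continuous_on_subset)
    qed (use le r in auto)
    then show ?thesis
      using r by (simp add: fps_expansion_def norm_divide field_simps)
  qed
  then have "eventually (\<lambda>r. ?c * r ^ n \<le> 1) (at_left (1::real))"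
    unfolding eventually_at_left_field by (auto intro!: exI[of _ 0])
  moreover have "((\<lambda>r. ?c * r ^ n) \<longlongrightarrow> ?c * 1 ^ n) (at_left (1::real))"
    by (intro tendsto_intros)
  ultimately have "?c * 1 ^ n \<le> 1"
    by (intro tendsto_upperbound[of _ _ "at_left 1"]) auto
  then show ?thesis by simp
qed

text \<open>Logarithmic differentiation of \<open>z * exp (L z)\<close>, kept in product form so
  that it also holds at the origin, where \<open>f\<close> vanishes.\<close>

lemma times_deriv_times_exp:
  assumes L: "L holomorphic_on \<Omega>" and feq: "\<And>z. z \<in> \<Omega> \<Longrightarrow> f z = z * exp (L z)"
    and z: "z \<in> \<Omega>"
  shows "z * deriv f z = f z * (1 + z * deriv L z)"
proof -
  have dL: "(L has_field_derivative deriv L z) (at z)"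
    using L z by (simp add: holomorphic_derivI)
  have "((\<lambda>z. z * exp (L z)) has_field_derivative exp (L z) * (1 + z * deriv L z)) (at z)"
    by (auto intro!: derivative_eq_intros dL simp: algebra_simps)
  then have "(f has_field_derivative exp (L z) * (1 + z * deriv L z)) (at z)"
    by (rule has_field_derivative_transform_within_open[where S = \<Omega>]) (use z feq in auto)
  then have "deriv f z = exp (L z) * (1 + z * deriv L z)"
    by (rule DERIV_imp_deriv)
  then show ?thesis using feq[OF z] by simp
qed

text \<open>Applying the sine to the subordination relation gives
  \<open>sin (pi / 2 * z * deriv L z) = \<omega> z\<close>, with \<open>L\<close> the logarithm of
  \<open>f z / z\<close>. As the sine series is x + O(x^3), the first two coefficients of
  \<open>\<omega>\<close> are those of its argument, namely
  \<open>pi * n * log_coeff f n\<close>.\<close>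

lemma log_coeff_arcsin:
  assumes f: "f \<in> class_S" and sch: "schwarz_function \<omega>"
    and rel: "\<And>z. z \<in> \<Omega> \<Longrightarrow> (if z = 0 then 1 else z * deriv f z / f z) = 1 + 2 / of_real pi * Arcsin (\<omega> z)"
  defines "c \<equiv> fps_nth (fps_expansion \<omega> 0)"
  shows "log_coeff f 1 = c 1 / of_real pi" and "log_coeff f 2 = c 2 / (2 * of_real pi)"
proof -
  define L where "L = log_ratio f"
  define G where "G = fps_expansion L 0"
  have L: "L holomorphic_on \<Omega>" "L 0 = 0" "\<And>z. z \<in> \<Omega> - {0} \<Longrightarrow> exp (L z) = f z / z"
    using is_log_ratio_log_ratio[OF f] by (auto simp: L_def is_log_ratio_def)
  have f0: "f 0 = 0"
    using f by (auto simp: class_S_def class_A_def)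
  have feq: "f z = z * exp (L z)" if "z \<in> \<Omega>" for z
    using L(3)[of z] that f0 by (cases "z = 0") auto
  \<comment> \<open>The sine undoes \<open>Arcsin\<close> on the whole plane, so this form is free
    of branch cuts even where \<open>\<omega> z\<close> has modulus 1.\<close>
  have sin_eq: "sin (of_real pi / 2 * (z * deriv L z)) = \<omega> z" if z: "z \<in> \<Omega>" for z
  proof (cases "z = 0")
    case True
    then show ?thesis using sch by (simp add: schwarz_function_def)
  next
    case False
    have "f z \<noteq> 0" using feq[OF z] False by simp
    then have "1 + z * deriv L z = 1 + 2 / of_real pi * Arcsin (\<omega> z)"
      using rel[OF z] False times_deriv_times_exp[OF L(1) feq z] by simp
    then have "of_real pi / 2 * (z * deriv L z) = Arcsin (\<omega> z)"
      by simp
    then show ?thesis by simp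
  qed
  have hol: "\<omega> holomorphic_on \<Omega>"
    using sch by (simp add: schwarz_function_def)
  have W: "\<omega> has_fps_expansion fps_expansion \<omega> 0" and G: "L has_fps_expansion G"
    unfolding G_def using hol L(1) by (auto intro: has_fps_expansion_fps_expansion[of \<Omega>])
  define F where "F = fps_const (of_real pi / 2) * (fps_X * fps_deriv G)"
  have F0: "fps_nth F 0 = 0"
    by (simp add: F_def)
  have "(\<lambda>z. of_real pi / 2 * (z * deriv L z)) has_fps_expansion F"
    unfolding F_def by (intro fps_expansion_intros G)
  from has_fps_expansion_compose[OF has_fps_expansion_sin[of 1] this F0]
  have "(\<lambda>z. sin (of_real pi / 2 * (z * deriv L z))) has_fps_expansion (fps_sin 1 oo F)"
    by (simp add: o_def)
  moreover have ev: "eventually (\<lambda>z. sin (of_real pi / 2 * (z * deriv L z)) = \<omega> z) (nhds 0)"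
    using sin_eq by (auto simp: eventually_nhds intro!: exI[of _ \<Omega>])
  ultimately have "\<omega> has_fps_expansion (fps_sin 1 oo F)"
    using has_fps_expansion_cong[OF ev refl] by blast
  then have eq: "fps_expansion \<omega> 0 = fps_sin 1 oo F"
    using W fps_expansion_unique_complex by blast
  have "c 1 = fps_nth F 1"
    using F0 by (simp add: c_def eq fps_compose_nth fps_sin_def)
  then show "log_coeff f 1 = c 1 / of_real pi"
    by (simp add: F_def log_coeff_def G_def L_def)
  \<comment> \<open>The square of \<open>F\<close> has a term of degree 2, but the quadratic
    coefficient of the sine is 0.\<close>
  have "c 2 = fps_nth F 2"
    using F0 by (simp add: c_def eq fps_compose_nth fps_sin_def numeral_2_eq_2)
  then show "log_coeff f 2 = c 2 / (2 * of_real pi)"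
    by (simp add: F_def log_coeff_def G_def L_def numeral_2_eq_2)
qed

text \<open>The equation \<open>z * deriv L z = A z\<close> is solved by a primitive of
  \<open>A z / z\<close>, and \<open>f z = z * exp (L z)\<close> then has the prescribed
  \<open>\<omega>\<close>. This supplies the extremal functions.\<close>

lemma class_S_arcsin_exists:
  assumes sch: "schwarz_function \<omega>" and lt: "\<And>z. z \<in> \<Omega> \<Longrightarrow> norm (\<omega> z) < 1"
  obtains f where "f \<in> class_S_arcsin"
    "log_coeff f 1 = fps_nth (fps_expansion \<omega> 0) 1 / of_real pi"
    "log_coeff f 2 = fps_nth (fps_expansion \<omega> 0) 2 / (2 * of_real pi)"
proof -
  have hol: "\<omega> holomorphic_on \<Omega>" and w0: "\<omega> 0 = 0"
    using sch by (auto simp: schwarz_function_def)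
  define A where "A = (\<lambda>z. 2 / of_real pi * Arcsin (\<omega> z))"
  define q where "q = (\<lambda>z. if z = 0 then deriv A 0 else A z / z)"
  \<comment> \<open>Keeps \<open>\<omega> z\<close> off the cuts of \<open>Arcsin\<close>, which are
    the real rays outside (-1, 1), and gives the strict bound on
    \<open>Re (Arcsin (\<omega> z))\<close> used for \<open>pos\<close>.\<close>
  have Re_lt: "\<bar>Re (\<omega> z)\<bar> < 1" if "z \<in> \<Omega>" for z
    using lt[OF that] abs_Re_le_cmod[of "\<omega> z"] by linarith
  have "(Arcsin \<circ> \<omega>) holomorphic_on \<Omega>"
    using Re_lt by (intro holomorphic_on_compose hol holomorphic_on_Arcsin) auto
  then have Ahol: "A holomorphic_on \<Omega>"
    unfolding A_def o_def by (intro holomorphic_intros)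
  have A0: "A 0 = 0" by (simp add: A_def w0)
  have "q holomorphic_on \<Omega>"
    by (rule pole_theorem_open_0[OF Ahol, of 0]) (auto simp: q_def A0)
  then obtain M where M: "\<And>z. z \<in> \<Omega> \<Longrightarrow> (M has_field_derivative q z) (at z within \<Omega>)"
    using holomorphic_convex_primitive'[of \<Omega> q] by auto
  \<comment> \<open>The normalization \<open>L 0 = 0\<close> is what makes the derivative of
    \<open>f\<close> at 0 equal to 1.\<close>
  define L where "L = (\<lambda>z. M z - M 0)"
  have dL: "(L has_field_derivative q z) (at z)" if "z \<in> \<Omega>" for z
    using M[OF that] that unfolding L_def
    by (auto intro!: derivative_eq_intros simp: at_within_open[of z \<Omega>])
  have Lhol: "L holomorphic_on \<Omega>"
    using dL by (subst holomorphic_on_open) blast+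
  have dA: "z * deriv L z = A z" if "z \<in> \<Omega>" for z
    using DERIV_imp_deriv[OF dL[OF that]] by (simp add: q_def A0)
  define f where "f = (\<lambda>z. z * exp (L z))"
  \<comment> \<open>\<open>Arcsin\<close> maps the strip of real parts in (-1, 1) into real parts
    above \<open>- pi / 2\<close>; scaling by \<open>2 / pi\<close> gives
    \<open>Re (A z) > -1\<close>.\<close>
  have pos: "Re (1 + z * deriv L z) > 0" if z: "z \<in> \<Omega>" for z
  proof -
    have "- (pi / 2) < Re (Arcsin (\<omega> z))"
      using Arcsin_bounds[OF Re_lt[OF z]] by linarith
    then have "2 / pi * - (pi / 2) < 2 / pi * Re (Arcsin (\<omega> z))"
      by (rule mult_strict_left_mono) simp
    moreover have "A z = of_real (2 / pi) * Arcsin (\<omega> z)"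
      by (simp add: A_def)
    then have "Re (A z) = 2 / pi * Re (Arcsin (\<omega> z))"
      by (simp only: Re_complex_of_real Im_complex_of_real times_complex.sel)
    ultimately show ?thesis
      by (simp add: dA[OF z])
  qed
  have "(f has_field_derivative 1) (at 0)"
    unfolding f_def by (auto intro!: derivative_eq_intros dL[of 0]) (simp add: L_def)
  then have fS: "f \<in> class_S"
    unfolding class_S_def class_A_def
    using inj_on_times_exp[OF Lhol pos] Lhol
    by (auto simp: f_def intro!: holomorphic_intros DERIV_imp_deriv)
  have rel: "(if z = 0 then 1 else z * deriv f z / f z) = 1 + 2 / of_real pi * Arcsin (\<omega> z)"
    if z: "z \<in> \<Omega>" for z
    using times_deriv_times_exp[OF Lhol _ z, of f] dA[OF z] w0
    by (auto simp: f_def A_def)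
  show ?thesis
  proof
    show "f \<in> class_S_arcsin"
      using fS rel sch unfolding class_S_arcsin_def subordinate_def by blast
  qed (use log_coeff_arcsin[OF fS sch rel] in auto)
qed

theorem theorem4p3:
  shows "(\<forall>f \<in> class_S_arcsin.
      - (1 / pi) \<le> norm (log_coeff f 2) - norm (log_coeff f 1) \<and>
      norm (log_coeff f 2) - norm (log_coeff f 1) \<le> 1 / (2 * pi)) \<and>
    (\<exists>f \<in> class_S_arcsin. norm (log_coeff f 2) - norm (log_coeff f 1) = - (1 / pi)) \<and>
    (\<exists>f \<in> class_S_arcsin. norm (log_coeff f 2) - norm (log_coeff f 1) = 1 / (2 * pi))"
proof (intro conjI ballI)
  fix f assume "f \<in> class_S_arcsin"
  then obtain \<omega> where f: "f \<in> class_S" and sch: "schwarz_function \<omega>"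
    and rel: "\<And>z. z \<in> \<Omega> \<Longrightarrow> (if z = 0 then 1 else z * deriv f z / f z) = 1 + 2 / of_real pi * Arcsin (\<omega> z)"
    unfolding class_S_arcsin_def subordinate_def by blast
  let ?c = "fps_nth (fps_expansion \<omega> 0)"
  have "norm (log_coeff f 1) = norm (?c 1) / pi"
    by (subst log_coeff_arcsin(1)[OF f sch rel]) (auto simp: norm_divide)
  moreover have "norm (log_coeff f 2) = norm (?c 2) / (2 * pi)"
    by (subst log_coeff_arcsin(2)[OF f sch rel]) (auto simp: norm_divide norm_mult)
  ultimately have "norm (log_coeff f 1) \<le> 1 / pi" "norm (log_coeff f 2) \<le> 1 / (2 * pi)"
    using schwarz_function_coeff_le_1[OF sch] by (simp_all add: divide_right_mono del: One_nat_def)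
  \<comment> \<open>Each estimate discards one modulus: the lower one drops that of the second
    coefficient, the upper one that of the first.\<close>
  moreover have "0 \<le> norm (log_coeff f 1)" "0 \<le> norm (log_coeff f 2)"
    by auto
  ultimately show "- (1 / pi) \<le> norm (log_coeff f 2) - norm (log_coeff f 1)"
    and "norm (log_coeff f 2) - norm (log_coeff f 1) \<le> 1 / (2 * pi)"
    by linarith+
next
  \<comment> \<open>Lower bound: the coefficients 1 and 0 make the first modulus maximal and the
    second zero.\<close>
  have "schwarz_function (\<lambda>z. z)"
    by (auto simp: schwarz_function_def)
  moreover have "fps_expansion (\<lambda>z. z) 0 = (fps_X :: complex fps)"
    by (intro fps_expansion_unique_complex[OF has_fps_expansion_fps_expansion[of UNIV]]
        fps_expansion_intros) auto
  ultimately obtain f where "f \<in> class_S_arcsin"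
    "log_coeff f 1 = 1 / of_real pi" "log_coeff f 2 = 0"
    using class_S_arcsin_exists[of "\<lambda>z. z"] by auto
  then show "\<exists>f \<in> class_S_arcsin. norm (log_coeff f 2) - norm (log_coeff f 1) = - (1 / pi)"
    by (intro bexI[of _ f]) (simp_all add: norm_divide norm_mult)
next
  \<comment> \<open>Upper bound: the coefficients 0 and 1 reverse the roles.\<close>
  have "schwarz_function (\<lambda>z. z\<^sup>2)"
    by (auto simp: schwarz_function_def norm_power power_le_one intro!: holomorphic_intros)
  moreover have "norm (z\<^sup>2) < 1" if "z \<in> \<Omega>" for z :: complex
    using that by (simp add: norm_power power_less_one_iff)
  moreover have "fps_expansion (\<lambda>z. z\<^sup>2) 0 = (fps_X\<^sup>2 :: complex fps)"
    by (intro fps_expansion_unique_complex[OF has_fps_expansion_fps_expansion[of UNIV]]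
        fps_expansion_intros holomorphic_intros) auto
  ultimately obtain f where "f \<in> class_S_arcsin"
    "log_coeff f 1 = 0" "log_coeff f 2 = 1 / (2 * of_real pi)"
    using class_S_arcsin_exists[of "\<lambda>z. z\<^sup>2"] by auto
  then show "\<exists>f \<in> class_S_arcsin. norm (log_coeff f 2) - norm (log_coeff f 1) = 1 / (2 * pi)"
    by (intro bexI[of _ f]) (simp_all add: norm_divide norm_mult)
qed

end
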